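(* Let $I_\cap$ be a measure of shared information that satisfies the Williams–Beer axioms. Then $I_\cap$ has the secret sharing property: for every $n$, every access structure $\mathcal A$ on $\{1,\dots,n\}$, every perfect secret sharing scheme $(X_1,\dots,X_n,S)$ with access structure $\mathcal A$, and all $A_1,\dots,A_k\subseteq\{1,\dots,n\}$ ($k\ge1$), $$I_\cap(S;A_1,\dots,A_k)=\begin{cases}H(S),&\text{if }A_1,\dots,A_k\in\mathcal A,\\0,&\text{otherwise.}\end{cases}$$
   Context: All random variables take finitely many values; $H$ is Shannon entropy, $I$ is mutual information. For $A\subseteq\{1,\dots,n\}$ write $X_A=(X_i)_{i\in A}$ ($X_\emptyset$ is constant). **Measure of shared information.** A function $I_\cap$ assigning to jointly distributed random variables $S$ (the target) and $Y_1,\dots,Y_k$ ($k\ge1$) a real number $I_\cap(S;Y_1,\dots,Y_k)$. Given $X_1,\dots,X_n$ and $A_1,\dots,A_k\subseteq\{1,\dots,n\}$, write $I_\cap(S;A_1,\dots,A_k):=I_\cap(S;X_{A_1},\dots,X_{A_k})$. **Williams–Beer axioms.** (Symmetry) $I_\cap(S;Y_1,\dots,Y_k)$ is symmetric under permutations of $Y_1,\dots,Y_k$. (Self-redundancy) $I_\cap(S;Y_1)=I(S;Y_1)$. (Monotonicity) $I_\cap(S;Y_1,\dots,Y_k,Y_{k+1})\le I_\cap(S;Y_1,\dots,Y_k)$, with equality if $Y_i$ is a function of $Y_{k+1}$ for some $i\in\{1,\dots,k\}$. **Access structures and secret sharing.** An access structure $\mathcal A$ on $\{1,\dots,n\}$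 is a family of subsets of $\{1,\dots,n\}$ closed under taking supersets; its elements are called authorized. A perfect secret sharing scheme with access structure $\mathcal A$ is a family of random variables $S,X_1,\dots,X_n$ with $H(X_A,S)=H(X_A)$ whenever $A\in\mathcal A$ and $H(X_A,S)=H(X_A)+H(S)$ whenever $A\notin\mathcal A$. *)

theory Defs
  imports "HOL-Probability.Probability"
begin

text \<open>
  A random variable with finitely many values is a \<open>simple_function\<close> on a probability space \<open>M\<close>.
  The base \<open>b > 1\<close> of the logarithm is a parameter, the same for all information quantities.
\<close>

definition shannon_entropy :: "real \<Rightarrow> 'w measure \<Rightarrow> ('w \<Rightarrow> 'v) \<Rightarrow> real" where
  "shannon_entropy b M X = prob_space.entropy M b (count_space (X ` space M)) X"

definition mutual_info :: "real \<Rightarrow> 'w measure \<Rightarrow> ('w \<Rightarrow> 'u) \<Rightarrow> ('w \<Rightarrow> 'v) \<Rightarrow> real" where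
  "mutual_info b M X Y =
     prob_space.mutual_information M b
       (count_space (X ` space M)) (count_space (Y ` space M)) X Y"

text \<open>
  A measure of shared information is applied to a probability space, a target \<open>S\<close> and a list
  \<open>[Y\<^sub>1, \<dots>, Y\<^sub>k]\<close> of sources on it. Only nonempty lists of simple functions on probability
  spaces are meaningful arguments; the axioms say nothing about the others. The value may depend
  on the random variables themselves; a measure that depends only on their joint distribution
  is a special case.
\<close>

type_synonym ('w, 's, 'y) shared_info =
  "'w measure \<Rightarrow> ('w \<Rightarrow> 's) \<Rightarrow> ('w \<Rightarrow> 'y) list \<Rightarrow> real"

definition admissible :: "'w measure \<Rightarrow> ('w \<Rightarrow> 's) \<Rightarrow> ('w \<Rightarrow> 'y) list \<Rightarrow> bool" where
  "admissible M S Ys \<longleftrightarrow>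
     prob_space M \<and> simple_function M S \<and> Ys \<noteq> [] \<and> (\<forall>Y\<in>set Ys. simple_function M Y)"

text \<open>
  Functional dependence is understood almost surely, since entropy identities do not see null sets.
\<close>

definition is_function_of :: "'w measure \<Rightarrow> ('w \<Rightarrow> 'u) \<Rightarrow> ('w \<Rightarrow> 'v) \<Rightarrow> bool" where
  "is_function_of M Y Z \<longleftrightarrow> (\<exists>f. AE \<omega> in M. Y \<omega> = f (Z \<omega>))"

definition WB_symmetry :: "('w, 's, 'y) shared_info \<Rightarrow> bool" where
  "WB_symmetry I \<longleftrightarrow>
     (\<forall>M S Ys Zs. admissible M S Ys \<longrightarrow> mset Zs = mset Ys \<longrightarrow> I M S Zs = I M S Ys)"

definition WB_self_redundancy :: "real \<Rightarrow> ('w, 's, 'y) shared_info \<Rightarrow> bool" where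
  "WB_self_redundancy b I \<longleftrightarrow>
     (\<forall>M S Y. admissible M S [Y] \<longrightarrow> I M S [Y] = mutual_info b M S Y)"

definition WB_monotonicity :: "('w, 's, 'y) shared_info \<Rightarrow> bool" where
  "WB_monotonicity I \<longleftrightarrow>
     (\<forall>M S Ys Z. admissible M S Ys \<longrightarrow> simple_function M Z \<longrightarrow>
        I M S (Ys @ [Z]) \<le> I M S Ys \<and>
        ((\<exists>Y\<in>set Ys. is_function_of M Y Z) \<longrightarrow> I M S (Ys @ [Z]) = I M S Ys))"

definition williams_beer :: "real \<Rightarrow> ('w, 's, 'y) shared_info \<Rightarrow> bool" where
  "williams_beer b I \<longleftrightarrow> WB_symmetry I \<and> WB_self_redundancy b I \<and> WB_monotonicity I"

text \<open>
  The tuple \<open>X\<^sub>A\<close> is the random variable \<open>\<omega> \<mapsto> (X\<^sub>i \<omega>)\<^sub>i\<^sub>\<in>\<^sub>A\<close>, encoded as a function on indices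
  that is \<open>undefined\<close> outside \<open>A\<close>; in particular it is constant for \<open>A = {}\<close>.
\<close>

definition tuple :: "(nat \<Rightarrow> 'w \<Rightarrow> 'x) \<Rightarrow> nat set \<Rightarrow> 'w \<Rightarrow> nat \<Rightarrow> 'x" where
  "tuple X A = (\<lambda>\<omega>. \<lambda>i\<in>A. X i \<omega>)"

definition access_structure :: "nat \<Rightarrow> nat set set \<Rightarrow> bool" where
  "access_structure n \<A> \<longleftrightarrow>
     \<A> \<subseteq> Pow {1..n} \<and> (\<forall>A\<in>\<A>. \<forall>B. A \<subseteq> B \<longrightarrow> B \<subseteq> {1..n} \<longrightarrow> B \<in> \<A>)"

definition perfect_secret_sharing ::
  "real \<Rightarrow> 'w measure \<Rightarrow> nat \<Rightarrow> nat set set \<Rightarrow> ('w \<Rightarrow> 's) \<Rightarrow> (nat \<Rightarrow> 'w \<Rightarrow> 'x) \<Rightarrow> bool" where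
  "perfect_secret_sharing b M n \<A> S X \<longleftrightarrow>
     prob_space M \<and> simple_function M S \<and> (\<forall>i\<in>{1..n}. simple_function M (X i)) \<and>
     (\<forall>A\<subseteq>{1..n}.
        shannon_entropy b M (\<lambda>\<omega>. (tuple X A \<omega>, S \<omega>)) =
          (if A \<in> \<A> then shannon_entropy b M (tuple X A)
           else shannon_entropy b M (tuple X A) + shannon_entropy b M S))"

definition secret_sharing_property ::
  "real \<Rightarrow> ('w, 's, nat \<Rightarrow> 'x) shared_info \<Rightarrow> bool" where
  "secret_sharing_property b I \<longleftrightarrow>
     (\<forall>M n \<A> S (X :: nat \<Rightarrow> 'w \<Rightarrow> 'x) As.
        access_structure n \<A> \<longrightarrow> perfect_secret_sharing b M n \<A> S X \<longrightarrow>
        As \<noteq> [] \<longrightarrow> (\<forall>A\<in>set As. A \<subseteq> {1..n}) \<longrightarrow>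
        I M S (map (tuple X) As) =
          (if \<forall>A\<in>set As. A \<in> \<A> then shannon_entropy b M S else 0))"

end

theory Submission
  imports Defs
begin

text \<open>
  An unauthorized tuple has no mutual information with \<open>S\<close>, so monotonicity bounds the shared
  information above by 0; adding the constant tuple \<open>X\<^sub>\<emptyset>\<close>, a function of every tuple, bounds it
  below by 0. If all tuples are authorized, then \<open>S\<close> is almost surely a function of each of them,
  so adding \<open>S\<close> itself as a source gives \<open>H(S) = I\<^sub>\<inter>(S;S) = I\<^sub>\<inter>(S;S,A\<^sub>1,\<dots>,A\<^sub>k) \<le> I\<^sub>\<inter>(S;A\<^sub>1,\<dots>,A\<^sub>k)\<close>,
  while \<open>I\<^sub>\<inter>(S;A\<^sub>1,\<dots>,A\<^sub>k) \<le> I(S;X\<^bsub>A\<^sub>1\<^esub>) = H(S)\<close>.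
\<close>

section \<open>Vanishing conditional entropy and almost sure functional dependence\<close>

text \<open>The values of probability 0 are finitely many, so their preimages together form a null
  set.\<close>

lemma simple_function_AE_prob_pos:
  assumes "prob_space M" "simple_function M Y"
  shows "AE \<omega> in M. 0 < measure M (Y -` {Y \<omega>} \<inter> space M)"
proof -
  interpret prob_space M by fact
  have "AE \<omega> in M. \<forall>v\<in>Y ` space M. prob (Y -` {v} \<inter> space M) = 0 \<longrightarrow> Y \<omega> \<noteq> v"
  proof (intro AE_finite_allI)
    fix v assume "v \<in> Y ` space M"
    have ev: "Y -` {v} \<inter> space M \<in> sets M"
      using assms(2) by (rule simple_functionD)
    show "AE \<omega> in M. prob (Y -` {v} \<inter> space M) = 0 \<longrightarrow> Y \<omega> \<noteq> v"
    proof (cases "prob (Y -` {v} \<inter> space M) = 0")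
      case True
      then have "AE \<omega> in M. \<omega> \<notin> Y -` {v} \<inter> space M"
        using prob_eq_0[OF ev] by simp
      then show ?thesis by (rule AE_mp) (auto intro!: AE_I2)
    qed simp
  qed (use assms(2) in \<open>auto dest: simple_functionD\<close>)
  then show ?thesis
    by (rule AE_mp) (auto intro!: AE_I2 simp: zero_less_measure_iff measure_nonneg)
qed

lemma is_function_ofI:
  assumes "AE \<omega> in M. Y \<omega> = f (Z \<omega>)"
  shows "is_function_of M Y Z"
  unfolding is_function_of_def using assms by (rule exI[where x = f])

text \<open>Since \<open>p (x, y) \<le> q y\<close>, the conditional entropy is a sum of nonnegative
  terms. It vanishes iff each pair carries either no mass or all the mass of its
  \<open>y\<close>.\<close>

lemma conditional_entropy_eq_0_iff:
  assumes "information_space M b" "simple_function M X" "simple_function M Y"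
  shows "prob_space.conditional_entropy M b (count_space (X ` space M)) (count_space (Y ` space M)) X Y = 0
    \<longleftrightarrow> is_function_of M X Y"
proof -
  interpret information_space M b by fact
  let ?XY = "\<lambda>\<omega>. (X \<omega>, Y \<omega>)"
  define q where "q y = prob (Y -` {y} \<inter> space M)" for y
  define p where "p z = prob (?XY -` {z} \<inter> space M)" for z
  have sXY: "simple_function M ?XY"
    using assms by auto
  have Y: "simple_distributed M Y q"
    unfolding q_def by (rule simple_distributedI[OF assms(3) measure_nonneg refl])
  have XY: "simple_distributed M ?XY p"
    unfolding p_def by (rule simple_distributedI[OF sXY measure_nonneg refl])
  have Yev: "Y -` {y} \<inter> space M \<in> events" for y
    using assms(3) by (rule simple_functionD)
  have XYev: "?XY -` {z} \<inter> space M \<in> events" for z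
    using sXY by (rule simple_functionD)
  have p0: "0 \<le> p z" for z
    by (simp add: p_def)
  have pq: "p (x, y) \<le> q y" for x y
    unfolding p_def q_def by (rule finite_measure_mono) (use Yev in auto)
  have term_le: "p (x, y) * log b (p (x, y) / q y) \<le> 0" for x y
  proof (cases "p (x, y) = 0")
    case False
    then have "0 < p (x, y)" "0 < q y"
      using p0[of "(x, y)"] pq[of x y] by auto
    then show ?thesis
      using pq[of x y] b_gt_1 by (intro mult_nonneg_nonpos) auto
  qed simp
  have term_0: "p (x, y) * log b (p (x, y) / q y) = 0 \<longleftrightarrow> p (x, y) = 0 \<or> p (x, y) = q y" for x y
  proof (cases "p (x, y) = 0")
    case False
    then have "0 < p (x, y)" "0 < q y"
      using p0[of "(x, y)"] pq[of x y] by auto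
    then show ?thesis
      using b_gt_1 by (auto simp: log_def)
  qed simp
  have "conditional_entropy b (count_space (X ` space M)) (count_space (Y ` space M)) X Y = 0
    \<longleftrightarrow> (\<Sum>(x, y)\<in>?XY ` space M. - (p (x, y) * log b (p (x, y) / q y))) = 0"
    by (simp add: conditional_entropy_eq[OF Y XY] split_beta sum_negf)
  also have "\<dots> \<longleftrightarrow> (\<forall>(x, y)\<in>?XY ` space M. p (x, y) * log b (p (x, y) / q y) = 0)"
    using simple_functionD(1)[OF sXY] term_le by (subst sum_nonneg_eq_0_iff) auto
  also have "\<dots> \<longleftrightarrow> (\<forall>(x, y)\<in>?XY ` space M. p (x, y) = 0 \<or> p (x, y) = q y)"
    by (simp only: term_0)
  also have "\<dots> \<longleftrightarrow> is_function_of M X Y"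
  proof
    assume *: "\<forall>(x, y)\<in>?XY ` space M. p (x, y) = 0 \<or> p (x, y) = q y"
    have full: "p (x, y) = q y" if "0 < p (x, y)" for x y
    proof -
      have "?XY -` {(x, y)} \<inter> space M \<noteq> {}"
        using that unfolding p_def by (metis measure_empty less_irrefl)
      then have "(x, y) \<in> ?XY ` space M" by auto
      then show ?thesis using * that by auto
    qed
    \<comment> \<open>Two such values would give disjoint events inside \<open>Y = y\<close>, each
      of probability \<open>q y > 0\<close>.\<close>
    have uniq: "x = x'" if "0 < p (x, y)" "0 < p (x', y)" for x x' y
    proof (rule ccontr)
      assume "x \<noteq> x'"
      then have "p (x, y) + p (x', y) = prob ((?XY -` {(x, y)} \<inter> space M) \<union> (?XY -` {(x', y)} \<inter> space M))"
        unfolding p_def by (intro finite_measure_Union[symmetric] XYev) auto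
      also have "\<dots> \<le> q y"
        unfolding q_def by (rule finite_measure_mono) (use Yev in auto)
      finally show False
        using full[OF that(1)] full[OF that(2)] that by linarith
    qed
    have "AE \<omega> in M. 0 < p (?XY \<omega>)"
      unfolding p_def by (rule simple_function_AE_prob_pos[OF prob_space_axioms sXY])
    \<comment> \<open>Almost surely \<open>X \<omega>\<close> is itself a candidate for the choice,
      and by \<open>uniq\<close> the only one.\<close>
    then have "AE \<omega> in M. X \<omega> = (SOME x. 0 < p (x, Y \<omega>))"
      by (rule AE_mp) (auto intro!: AE_I2 intro: uniq someI)
    then show "is_function_of M X Y"
      by (rule is_function_ofI)
  next
    assume "is_function_of M X Y"
    then obtain f where f: "AE \<omega> in M. X \<omega> = f (Y \<omega>)"
      unfolding is_function_of_def by auto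
    \<comment> \<open>The joint distribution is concentrated on the graph of \<open>f\<close>: pairs
      off it have mass 0, and a pair on it takes all of \<open>q y\<close>.\<close>
    have "p (x, y) = 0" if "x \<noteq> f y" for x y
    proof -
      have "AE \<omega> in M. \<omega> \<notin> ?XY -` {(x, y)} \<inter> space M"
        using f by (rule AE_mp) (use that in \<open>auto intro!: AE_I2\<close>)
      then show ?thesis
        unfolding p_def using prob_eq_0[OF XYev] by blast
    qed
    moreover have "p (f y, y) = q y" for y
      unfolding p_def q_def
    proof (rule finite_measure_eq_AE[OF _ XYev Yev])
      show "AE \<omega> in M. \<omega> \<in> ?XY -` {(f y, y)} \<inter> space M \<longleftrightarrow> \<omega> \<in> Y -` {y} \<inter> space M"
        using f by (rule AE_mp) (auto intro!: AE_I2)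
    qed
    ultimately show "\<forall>(x, y)\<in>?XY ` space M. p (x, y) = 0 \<or> p (x, y) = q y"
      by auto metis
  qed
  finally show ?thesis .
qed

text \<open>Combines I(S;Y) = H(S) - H(S|Y) with the chain rule. The pair has the order used in
  \<open>perfect_secret_sharing\<close>.\<close>

lemma mutual_info_eq_entropy_diff:
  assumes "information_space M b" "simple_function M S" "simple_function M Y"
  shows "mutual_info b M S Y =
    shannon_entropy b M S + shannon_entropy b M Y - shannon_entropy b M (\<lambda>\<omega>. (Y \<omega>, S \<omega>))"
proof -
  interpret information_space M b by fact
  show ?thesis
    using mutual_information_eq_entropy_conditional_entropy[OF assms(2,3)]
      entropy_chain_rule[OF assms(3,2)]
    by (simp add: mutual_info_def shannon_entropy_def)
qed

lemma mutual_info_eq_entropy_iff: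
  assumes "information_space M b" "simple_function M S" "simple_function M Y"
  shows "mutual_info b M S Y = shannon_entropy b M S \<longleftrightarrow> is_function_of M S Y"
proof -
  interpret information_space M b by fact
  show ?thesis
    using mutual_information_eq_entropy_conditional_entropy[OF assms(2,3)]
      conditional_entropy_eq_0_iff[OF assms]
    by (simp add: mutual_info_def shannon_entropy_def)
qed

lemma simple_function_tuple:
  assumes "finite A" "\<And>i. i \<in> A \<Longrightarrow> simple_function M (X i)"
  shows "simple_function M (tuple X A)"
  using assms
proof (induction A rule: finite_induct)
  case empty
  then show ?case by (simp add: tuple_def)
next
  case (insert a A)
  have "tuple X (insert a A) = (\<lambda>\<omega>. (tuple X A \<omega>)(a := X a \<omega>))"
    by (auto simp: tuple_def fun_eq_iff)
  then show ?case
    using insert by (simp add: simple_function_compose2[where h = "\<lambda>f x. f(a := x)"] del: fun_upd_apply)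
qed

section \<open>Bounds on shared information from the Williams-Beer axioms\<close>

lemma WB_append_le:
  assumes "WB_monotonicity I" "admissible M S Ys" "\<forall>Z\<in>set Zs. simple_function M Z"
  shows "I M S (Ys @ Zs) \<le> I M S Ys"
  using assms(3)
proof (induction Zs rule: rev_induct)
  case (snoc Z Zs)
  then have "admissible M S (Ys @ Zs)"
    using assms(2) by (auto simp: admissible_def)
  then have "I M S ((Ys @ Zs) @ [Z]) \<le> I M S (Ys @ Zs)"
    using assms(1) snoc.prems unfolding WB_monotonicity_def by (meson in_set_conv_decomp)
  then show ?case using snoc by simp
qed simp

text \<open>The equality case can be iterated because a \<open>Y\<close> that depends on the new
  source stays in the growing list.\<close>

lemma WB_append_eq:
  assumes "WB_monotonicity I" "admissible M S Ys"
    and "\<forall>Z\<in>set Zs. simple_function M Z \<and> (\<exists>Y\<in>set Ys. is_function_of M Y Z)"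
  shows "I M S (Ys @ Zs) = I M S Ys"
  using assms(3)
proof (induction Zs rule: rev_induct)
  case (snoc Z Zs)
  then have "admissible M S (Ys @ Zs)"
    using assms(2) by (auto simp: admissible_def)
  moreover have "\<exists>Y\<in>set (Ys @ Zs). is_function_of M Y Z" "simple_function M Z"
    using snoc.prems by auto
  ultimately have "I M S ((Ys @ Zs) @ [Z]) = I M S (Ys @ Zs)"
    using assms(1) unfolding WB_monotonicity_def by blast
  then show ?case using snoc by simp
qed simp

text \<open>Symmetry brings \<open>Y\<close> to the front; dropping all other sources can only
  increase the value, and self-redundancy evaluates what remains.\<close>

lemma WB_le_mutual_info:
  assumes "williams_beer b I" "admissible M S Ys" "Y \<in> set Ys"
  shows "I M S Ys \<le> mutual_info b M S Y"
proof -
  have adm: "admissible M S [Y]" and sf: "\<forall>Z\<in>set (remove1 Y Ys). simple_function M Z"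
    using assms(2,3) set_remove1_subset[of Y Ys] by (auto simp: admissible_def)
  have "mset ([Y] @ remove1 Y Ys) = mset Ys"
    using assms(3) by simp
  then have "I M S Ys = I M S ([Y] @ remove1 Y Ys)"
    using assms(1,2) unfolding williams_beer_def WB_symmetry_def by metis
  also have "\<dots> \<le> I M S [Y]"
    using assms(1) adm sf unfolding williams_beer_def by (intro WB_append_le) auto
  also have "\<dots> = mutual_info b M S Y"
    using assms(1) adm unfolding williams_beer_def WB_self_redundancy_def by blast
  finally show ?thesis .
qed

text \<open>Lower bound by information common to all sources. With \<open>Z\<close> in front,
  appending \<open>Ys\<close> changes nothing; with \<open>Z\<close> at the end, dropping it can
  only increase the value. It serves both for the constant tuple and for a copy of the
  secret.\<close>

lemma mutual_info_le_WB:
  fixes I :: "('w, 's, 'y) shared_info" and Z :: "'w \<Rightarrow> 'y"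
  assumes "williams_beer b I" "admissible M S Ys" "simple_function M Z"
    and "\<forall>Y\<in>set Ys. is_function_of M Z Y"
  shows "mutual_info b M S Z \<le> I M S Ys"
proof -
  have adm: "admissible M S [Z]"
    using assms(2,3) by (auto simp: admissible_def)
  have "mutual_info b M S Z = I M S [Z]"
    using assms(1) adm unfolding williams_beer_def WB_self_redundancy_def by simp
  also have "\<dots> = I M S ([Z] @ Ys)"
    using assms adm unfolding williams_beer_def
    by (intro WB_append_eq[symmetric]) (auto simp: admissible_def)
  also have "\<dots> = I M S (Ys @ [Z])"
  proof -
    have "admissible M S (Ys @ [Z])" "mset ([Z] @ Ys) = mset (Ys @ [Z])"
      using assms(2,3) by (auto simp: admissible_def)
    then show ?thesis
      using assms(1) unfolding williams_beer_def WB_symmetry_def by metis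
  qed
  also have "\<dots> \<le> I M S Ys"
    using assms unfolding williams_beer_def by (intro WB_append_le) auto
  finally show ?thesis .
qed

text \<open>
  The target itself cannot serve as a source, since its value type differs from that of the
  sources; the source \<open>Z\<close> is a relabelling of \<open>S\<close> by values of some \<open>Y\<close> that determines \<open>S\<close>.
\<close>

lemma WB_eq_entropy:
  assumes "information_space M b" "williams_beer b I" "admissible M S Ys"
    and func: "\<forall>Y\<in>set Ys. is_function_of M S Y"
  shows "I M S Ys = shannon_entropy b M S"
proof -
  obtain Y where Y: "Y \<in> set Ys"
    using assms(3) by (auto simp: admissible_def dest: hd_in_set)
  have sS: "simple_function M S" and sY: "simple_function M Y"
    using assms(3) Y by (auto simp: admissible_def)
  obtain f where f: "AE \<omega> in M. S \<omega> = f (Y \<omega>)"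
    using func Y unfolding is_function_of_def by blast
  define Z where "Z = (\<lambda>\<omega>. inv f (S \<omega>))"
  have sZ: "simple_function M Z"
    unfolding Z_def using sS by (rule simple_function_compose1)
  \<comment> \<open>Almost surely \<open>S \<omega>\<close> lies in the range of \<open>f\<close>,
    where \<open>inv f\<close> is a right inverse of \<open>f\<close>; so the relabelling loses no
    information.\<close>
  have "AE \<omega> in M. S \<omega> = f (Z \<omega>)"
    using f by (rule AE_mp) (auto intro!: AE_I2 simp: Z_def f_inv_into_f)
  then have "is_function_of M S Z"
    by (rule is_function_ofI)
  then have "shannon_entropy b M S = mutual_info b M S Z"
    using mutual_info_eq_entropy_iff[OF assms(1) sS sZ] by simp
  moreover have "is_function_of M Z Y'" if "Y' \<in> set Ys" for Y'
  proof -
    have "is_function_of M S Y'"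
      using func that by simp
    then obtain g where g: "AE \<omega> in M. S \<omega> = g (Y' \<omega>)"
      unfolding is_function_of_def by (rule exE)
    show ?thesis
      using g by (intro is_function_ofI[where f = "inv f \<circ> g"]) (auto simp: Z_def)
  qed
  then have "mutual_info b M S Z \<le> I M S Ys"
    by (intro mutual_info_le_WB assms sZ) auto
  moreover have "I M S Ys \<le> mutual_info b M S Y"
    by (rule WB_le_mutual_info[OF assms(2,3) Y])
  moreover have "mutual_info b M S Y = shannon_entropy b M S"
    using mutual_info_eq_entropy_iff[OF assms(1) sS sY] func Y by simp
  ultimately show ?thesis by simp
qed

theorem lemma2:
  fixes b :: real
    and I :: "('w, 's, nat \<Rightarrow> 'x) shared_info"
  assumes "1 < b"
    and "williams_beer b I"
  shows "secret_sharing_property b I"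
  unfolding secret_sharing_property_def
proof (intro allI impI)
  fix M :: "'w measure" and n \<A> and S :: "'w \<Rightarrow> 's" and X :: "nat \<Rightarrow> 'w \<Rightarrow> 'x" and As
  assume acc: "access_structure n \<A>" and pss: "perfect_secret_sharing b M n \<A> S X"
    and ne: "As \<noteq> []" and sub: "\<forall>A\<in>set As. A \<subseteq> {1..n}"
  have ps: "prob_space M" and sS: "simple_function M S"
    and sX: "\<forall>i\<in>{1..n}. simple_function M (X i)"
    using pss by (auto simp: perfect_secret_sharing_def)
  interpret prob_space M by (rule ps)
  have info: "information_space M b"
    using assms(1) by unfold_locales
  have st: "simple_function M (tuple X A)" if "A \<subseteq> {1..n}" for A
    using that sX by (intro simple_function_tuple) (auto intro: finite_subset)
  have adm: "admissible M S (map (tuple X) As)"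
    using ps sS ne sub st by (auto simp: admissible_def)
  \<comment> \<open>The two entropy conditions of a perfect scheme, restated as full or zero
    information about the secret.\<close>
  have mi: "mutual_info b M S (tuple X A) = (if A \<in> \<A> then shannon_entropy b M S else 0)"
    if "A \<subseteq> {1..n}" for A
    using mutual_info_eq_entropy_diff[OF info sS st[OF that]] pss that
    by (simp add: perfect_secret_sharing_def)
  show "I M S (map (tuple X) As) = (if \<forall>A\<in>set As. A \<in> \<A> then shannon_entropy b M S else 0)"
  proof (cases "\<forall>A\<in>set As. A \<in> \<A>")
    case True
    have "is_function_of M S (tuple X A)" if "A \<in> set As" for A
    proof -
      have "A \<subseteq> {1..n}" "A \<in> \<A>"
        using that sub True by auto
      then show ?thesis
        using mi[of A] mutual_info_eq_entropy_iff[OF info sS st[of A]] by simp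
    qed
    then have "\<forall>Y\<in>set (map (tuple X) As). is_function_of M S Y"
      by simp
    then have "I M S (map (tuple X) As) = shannon_entropy b M S"
      by (rule WB_eq_entropy[OF info assms(2) adm])
    with True show ?thesis by simp
  next
    case False
    then obtain A where A: "A \<in> set As" "A \<notin> \<A>" by auto
    \<comment> \<open>Otherwise closure under supersets would make \<open>A\<close>
      authorized.\<close>
    have "{} \<notin> \<A>"
      using acc A sub unfolding access_structure_def by blast
    then have "mutual_info b M S (tuple X {}) = 0"
      using mi[of "{}"] by simp
    \<comment> \<open>The empty tuple is the constant function with value \<open>undefined\<close>
      at every index.\<close>
    moreover have "is_function_of M (tuple X {}) Y" for Y :: "'w \<Rightarrow> nat \<Rightarrow> 'x"
      by (rule is_function_ofI[where f = "\<lambda>_ _. undefined"]) (simp add: tuple_def restrict_def)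
    ultimately have "0 \<le> I M S (map (tuple X) As)"
      using mutual_info_le_WB[OF assms(2) adm st[of "{}"]] by auto
    moreover have "I M S (map (tuple X) As) \<le> mutual_info b M S (tuple X A)"
      using A by (intro WB_le_mutual_info assms(2) adm) auto
    ultimately show ?thesis
      using mi[of A] A sub False by auto
  qed
qed

end
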